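(* Let $\Omega\subset\mathbb{R}^2$ be a (closed, bounded) polygonal domain with a triangular mesh. Suppose that $f:\Omega\to\mathbb{R}^2$ is bijective onto its image, orientation-preserving and $C^2$ on $\Omega$ (up to the boundary), with $\nabla f$ nonsingular. Let $T\subset\Omega$ be a (positively oriented, nondegenerate) triangle in the mesh with vertices $v_1,v_2,v_3$, and let $T'$ be the triangle whose vertices are $f(v_1),f(v_2),f(v_3)$. Let $h$ be the maximum side length of $T$, let $M>0$ be an upper bound on $\Vert\nabla^2 f\Vert$ in $T$, and let $\operatorname{asp}(T)=h/\operatorname{minalt}(T)$ be the aspect ratio of $T$, where $\operatorname{minalt}(T)$ is the minimum altitude of $T$. If $$\frac{\sigma_{\min}(\nabla f(v_1))}{M}>2h\operatorname{asp}(T),$$ then $T'$ is not reversed.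
   Context: $\nabla f(x)$ is the $2\times2$ Jacobian matrix of $f$ at $x$; orientation-preserving with nonsingular Jacobian means $\det\nabla f(x)>0$ for all $x\in\Omega$. $\sigma_{\min}$ denotes the smallest singular value of a matrix. $\nabla^2 f(x)$ is the second derivative of $f$ at $x$, a bilinear map $\mathbb{R}^2\times\mathbb{R}^2\to\mathbb{R}^2$, and $\Vert\nabla^2 f(x)\Vert$ is its operator norm with respect to the Euclidean norm, so that $\Vert\nabla^2 f(x)(u,w)\Vert\le M\Vert u\Vert\,\Vert w\Vert$ for all $x\in T$ and $u,w\in\mathbb{R}^2$. A triangle with ordered vertices $w_1,w_2,w_3$ is positively oriented (vertices in counterclockwise order) if and only if $\det(w_2-w_1,\,w_3-w_1)>0$, where $(w_2-w_1,\,w_3-w_1)$ is the $2\times 2$ matrix with these columns. All triangles of the mesh are positively oriented with the given vertex order. The triangle $T'$ is reversed if its orientation differs from that of $T$, i.e., its vertices $f(v_1),f(v_2),f(v_3)$ are in clockwise order: $\det(f(v_2)-f(v_1),\,f(v_3)-f(v_1))<0$. *)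

theory Defs
  imports "HOL-Analysis.Analysis"
begin

definition polygonal_domain :: "(real^2) set \<Rightarrow> bool" where
  "polygonal_domain \<Omega> \<longleftrightarrow>
     compact \<Omega> \<and> interior \<Omega> \<noteq> {} \<and> connected (interior \<Omega>) \<and> closure (interior \<Omega>) = \<Omega> \<and>
     (\<exists>E :: ((real^2) \<times> (real^2)) set. finite E \<and> frontier \<Omega> = (\<Union>(a, b)\<in>E. closed_segment a b))"

text \<open>The condition on intersections in \<^const>\<open>triangulation\<close> makes the mesh conforming: two
  triangles meet in a common face (edge, vertex or nothing). Mesh triangles are nondegenerate
  point sets; an order of the vertices is fixed when a triangle is used.\<close>

definition triangular_mesh :: "(real^2) set set \<Rightarrow> (real^2) set \<Rightarrow> bool" where
  "triangular_mesh \<T> \<Omega> \<longleftrightarrow> triangulation \<T> \<and> (\<forall>T\<in>\<T>. 2 simplex T) \<and> \<Union>\<T> = \<Omega>"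

definition columns_matrix :: "real^2 \<Rightarrow> real^2 \<Rightarrow> real^2^2" where
  "columns_matrix a b = transpose (vector [a, b])"

definition positively_oriented :: "real^2 \<Rightarrow> real^2 \<Rightarrow> real^2 \<Rightarrow> bool" where
  "positively_oriented w1 w2 w3 \<longleftrightarrow> det (columns_matrix (w2 - w1) (w3 - w1)) > 0"

definition negatively_oriented :: "real^2 \<Rightarrow> real^2 \<Rightarrow> real^2 \<Rightarrow> bool" where
  "negatively_oriented w1 w2 w3 \<longleftrightarrow> det (columns_matrix (w2 - w1) (w3 - w1)) < 0"

definition max_side :: "real^2 \<Rightarrow> real^2 \<Rightarrow> real^2 \<Rightarrow> real" where
  "max_side v1 v2 v3 = Max {dist v1 v2, dist v2 v3, dist v3 v1}"

definition altitude :: "real^2 \<Rightarrow> real^2 \<Rightarrow> real^2 \<Rightarrow> real" where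
  "altitude p a b = infdist p (affine hull {a, b})"

definition minalt :: "real^2 \<Rightarrow> real^2 \<Rightarrow> real^2 \<Rightarrow> real" where
  "minalt v1 v2 v3 = Min {altitude v1 v2 v3, altitude v2 v3 v1, altitude v3 v1 v2}"

definition asp :: "real^2 \<Rightarrow> real^2 \<Rightarrow> real^2 \<Rightarrow> real" where
  "asp v1 v2 v3 = max_side v1 v2 v3 / minalt v1 v2 v3"

definition singular_values :: "real^'n^'n \<Rightarrow> real set" where
  "singular_values A =
     {s. s \<ge> 0 \<and> (\<exists>x. x \<noteq> 0 \<and> (transpose A ** A) *v x = s\<^sup>2 *\<^sub>R x)}"

definition sigma_min :: "real^'n^'n \<Rightarrow> real" where
  "sigma_min A = Min (singular_values A)"

text \<open>\<open>C2_on f f' f'' \<Omega>\<close>: \<open>f\<close> is \<open>C\<^sup>2\<close> on \<open>\<Omega>\<close> up to the boundary, with first and second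
  derivatives \<open>f'\<close> and \<open>f''\<close>. At boundary points the derivatives are taken within \<open>\<Omega>\<close>; they are
  uniquely determined when \<open>\<Omega>\<close> is a union of nondegenerate triangles. The bilinear map is
  \<open>(u, w) \<mapsto> f'' x u w\<close>, and \<open>norm (f'' x)\<close> is the supremum of
  \<open>norm (f'' x u w) / (norm u * norm w)\<close>, its operator norm.\<close>

definition C2_on ::
  "(real^2 \<Rightarrow> real^2) \<Rightarrow> (real^2 \<Rightarrow> (real^2) \<Rightarrow>\<^sub>L (real^2)) \<Rightarrow>
   (real^2 \<Rightarrow> (real^2) \<Rightarrow>\<^sub>L (real^2) \<Rightarrow>\<^sub>L (real^2)) \<Rightarrow> (real^2) set \<Rightarrow> bool" where
  "C2_on f f' f'' \<Omega> \<longleftrightarrow>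
     (\<forall>x\<in>\<Omega>. (f has_derivative blinfun_apply (f' x)) (at x within \<Omega>)) \<and>
     (\<forall>x\<in>\<Omega>. (f' has_derivative blinfun_apply (f'' x)) (at x within \<Omega>)) \<and>
     continuous_on \<Omega> f''"

definition jacobian_matrix :: "((real^2) \<Rightarrow>\<^sub>L (real^2)) \<Rightarrow> real^2^2" where
  "jacobian_matrix L = matrix (blinfun_apply L)"

end

theory Submission
  imports Defs
begin

text \<open>Write \<open>J\<close> for the Jacobian at \<open>v1\<close>, \<open>\<sigma>\<close> for its smallest singular value and \<open>m\<close> for the minimal
  altitude of \<open>T\<close>. Taylor's formula on the convex set \<open>T\<close> gives \<open>f v - f v1 = J (v - v1) + e\<close> with
  \<open>norm e \<le> M h\<^sup>2 / 2\<close> at the vertices \<open>v2\<close>, \<open>v3\<close> (lemma \<open>linearization_error_le\<close>). Since \<open>J\<close> is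
  invertible and stretches every vector by at least \<open>\<sigma>\<close> (lemma \<open>sigma_min_times_norm_le\<close>), the error
  is \<open>J d\<close> for some \<open>d\<close> with \<open>norm d \<le> M h\<^sup>2 / (2 \<sigma>)\<close>, and the hypothesis \<open>\<sigma> / M > 2 h\<^sup>2 / m\<close> makes this
  less than \<open>m / 4\<close>. Hence, up to a translation, \<open>T'\<close> is the image under \<open>J\<close> of a triangle obtained
  from \<open>T\<close> by fixing \<open>v1\<close> and moving the two other vertices by less than \<open>m / 4\<close>.

  Such a move cannot reverse \<open>T\<close>. Twice the area of \<open>T\<close> is \<open>h m\<close>, and by multilinearity of the
  determinant the move changes it by at most \<open>h m / 4 + h m / 4 + m\<^sup>2 / 16 < h m\<close> (lemma
  \<open>positive_det_perturbed\<close>). As \<open>det J > 0\<close>, the map \<open>J\<close> preserves the orientation.\<close>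

section \<open>Oriented area in the plane\<close>

lemma det_columns_matrix: "det (columns_matrix a b) = a$1 * b$2 - b$1 * a$2"
  by (simp add: columns_matrix_def det_2 transpose_def)

lemma det_columns_matrix_mult:
  "det (columns_matrix (A *v a) (A *v b)) = det A * det (columns_matrix a b)"
  unfolding det_columns_matrix det_2[of A] matrix_vector_mult_def
  by (simp add: sum_2 algebra_simps)

lemma inner_sq_plus_det_sq:
  "(a \<bullet> b)\<^sup>2 + (det (columns_matrix a b))\<^sup>2 = (norm a * norm b)\<^sup>2"
  unfolding det_columns_matrix power_mult_distrib power2_norm_eq_inner
  by (simp add: inner_vec_def sum_2 power2_eq_square algebra_simps)

lemma abs_det_columns_matrix_le: "\<bar>det (columns_matrix a b)\<bar> \<le> norm a * norm b"
proof (rule power2_le_imp_le)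
  show "\<bar>det (columns_matrix a b)\<bar>\<^sup>2 \<le> (norm a * norm b)\<^sup>2"
    unfolding power2_abs inner_sq_plus_det_sq[symmetric] by simp
qed simp

lemma det_columns_matrix_cycle:
  "det (columns_matrix (c - b) (a - b)) = det (columns_matrix (b - a) (c - a))"
  by (simp add: det_columns_matrix algebra_simps)

section \<open>Altitudes\<close>

text \<open>Twice the area is base times height. Moving \<open>p\<close> parallel to the base does not change the
  determinant, so it bounds every distance from \<open>p\<close> to the base line from below, and it is attained
  at the foot of the perpendicular, where the inner product vanishes.\<close>

lemma altitude_times_base:
  "altitude p a b * dist a b = \<bar>det (columns_matrix (b - a) (p - a))\<bar>"
proof (cases "a = b")
  case True
  then show ?thesis by (simp add: det_columns_matrix)
next
  case False
  let ?D = "\<bar>det (columns_matrix (b - a) (p - a))\<bar>"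
  let ?pt = "\<lambda>t. a + t *\<^sub>R (b - a)"
  have pos: "norm (b - a) > 0" using False by simp
  have hull: "affine hull {a, b} = range ?pt" by (rule affine_hull_2_alt)
  have shift: "\<bar>det (columns_matrix (b - a) (p - ?pt t))\<bar> = ?D" for t
    by (simp add: det_columns_matrix algebra_simps)
  have lower: "?D / norm (b - a) \<le> dist p (?pt t)" for t
    using abs_det_columns_matrix_le[of "b - a" "p - ?pt t"] pos
    by (simp only: shift dist_norm) (simp add: pos_divide_le_eq mult.commute)
  have ge: "?D / norm (b - a) \<le> altitude p a b"
    unfolding altitude_def hull infdist_def
    using lower by (auto intro!: cINF_greatest)
  define t where "t = ((b - a) \<bullet> (p - a)) / ((b - a) \<bullet> (b - a))"
  have "(b - a) \<bullet> (p - ?pt t) = (b - a) \<bullet> (p - a) - t * ((b - a) \<bullet> (b - a))"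
    by (simp add: inner_diff_right inner_add_right inner_scaleR_right)
  also have "\<dots> = 0" using False by (simp add: t_def)
  finally have "?D\<^sup>2 = (norm (b - a) * norm (p - ?pt t))\<^sup>2"
    using inner_sq_plus_det_sq[of "b - a" "p - ?pt t"]
    unfolding shift[of t, symmetric] power2_abs by (simp only: power_zero_numeral add_0)
  then have "?D = norm (b - a) * norm (p - ?pt t)"
    by (rule power2_eq_imp_eq) auto
  then have "dist p (?pt t) = ?D / norm (b - a)"
    using pos by (simp add: dist_norm)
  moreover have "altitude p a b \<le> dist p (?pt t)"
    unfolding altitude_def hull by (rule infdist_le, rule rangeI)
  ultimately have "altitude p a b = ?D / norm (b - a)" using ge by linarith
  then show ?thesis using pos by (simp add: dist_norm norm_minus_commute)
qed

lemma altitudes_times_bases: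
  fixes v1 v2 v3 :: "real^2"
  defines "D \<equiv> \<bar>det (columns_matrix (v2 - v1) (v3 - v1))\<bar>"
  shows "altitude v1 v2 v3 * dist v2 v3 = D \<and> altitude v2 v3 v1 * dist v3 v1 = D \<and>
    altitude v3 v1 v2 * dist v1 v2 = D"
  unfolding D_def altitude_times_base det_columns_matrix_cycle[of v3 v2 v1]
    det_columns_matrix_cycle[of v1 v3 v2] by simp_all

text \<open>All products of an altitude with its base agree, so the bound comes from the longest side,
  whose altitude is at least the minimal one.\<close>

lemma max_side_times_minalt_le:
  "max_side v1 v2 v3 * minalt v1 v2 v3 \<le> \<bar>det (columns_matrix (v2 - v1) (v3 - v1))\<bar>"
proof -
  let ?m = "minalt v1 v2 v3"
  have m: "?m \<le> altitude v1 v2 v3" "?m \<le> altitude v2 v3 v1" "?m \<le> altitude v3 v1 v2"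
    by (simp_all add: minalt_def)
  have "max_side v1 v2 v3 \<in> {dist v1 v2, dist v2 v3, dist v3 v1}"
    unfolding max_side_def by (rule Max_in) auto
  then show ?thesis
    using altitudes_times_bases[of v1 v2 v3] mult_right_mono[OF m(1), of "dist v2 v3"]
      mult_right_mono[OF m(2), of "dist v3 v1"]
      mult_right_mono[OF m(3), of "dist v1 v2"]
    by (auto simp: mult.commute[of _ "minalt v1 v2 v3"])
qed

lemma minalt_pos:
  assumes "positively_oriented v1 v2 v3"
  shows "minalt v1 v2 v3 > 0"
proof -
  have "\<bar>det (columns_matrix (v2 - v1) (v3 - v1))\<bar> > 0"
    using assms by (simp add: positively_oriented_def)
  then have "altitude v1 v2 v3 * dist v2 v3 > 0" "altitude v2 v3 v1 * dist v3 v1 > 0"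
    "altitude v3 v1 v2 * dist v1 v2 > 0"
    by (simp_all only: altitudes_times_bases[of v1 v2 v3])
  then have "altitude v1 v2 v3 > 0" "altitude v2 v3 v1 > 0" "altitude v3 v1 v2 > 0"
    by (simp_all add: zero_less_mult_iff not_less)
  then show ?thesis by (simp add: minalt_def)
qed

lemma dist_le_max_side:
  "dist v1 v2 \<le> max_side v1 v2 v3" "dist v1 v3 \<le> max_side v1 v2 v3"
  by (auto simp: max_side_def dist_commute)

lemma minalt_le_max_side: "minalt v1 v2 v3 \<le> max_side v1 v2 v3"
proof -
  have "minalt v1 v2 v3 \<le> altitude v1 v2 v3" by (simp add: minalt_def)
  also have "\<dots> \<le> dist v1 v2"
    unfolding altitude_def by (rule infdist_le) (simp add: hull_inc)
  also have "\<dots> \<le> max_side v1 v2 v3" by (rule dist_le_max_side)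
  finally show ?thesis .
qed

text \<open>With \<open>h\<close> the longest side and \<open>m\<close> the minimal altitude, the determinant of the original
  triangle is at least \<open>h m\<close>. Expanding the perturbed one by multilinearity adds two mixed terms of
  absolute value at most \<open>h m / 4\<close> and one of at most \<open>m\<^sup>2 / 16 \<le> h m / 16\<close>, together less than
  \<open>h m\<close>.\<close>

lemma positive_det_perturbed:
  assumes "positively_oriented v1 v2 v3"
    and d: "norm d \<le> minalt v1 v2 v3 / 4" "norm e \<le> minalt v1 v2 v3 / 4"
  shows "det (columns_matrix (v2 - v1 + d) (v3 - v1 + e)) > 0"
proof -
  define h m where "h = max_side v1 v2 v3" and "m = minalt v1 v2 v3"
  let ?u = "v2 - v1" and ?w = "v3 - v1"
  have m: "m > 0" and mh: "m \<le> h"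
    using minalt_pos[OF assms(1)] minalt_le_max_side by (simp_all add: h_def m_def)
  have uw: "norm ?u \<le> h" "norm ?w \<le> h"
    using dist_le_max_side(1)[of v1 v2 v3] dist_le_max_side(2)[of v1 v3 v2]
    by (simp_all add: h_def dist_norm norm_minus_commute)
  have de: "norm d \<le> m / 4" "norm e \<le> m / 4" using d by (simp_all add: m_def)
  have main: "h * m \<le> det (columns_matrix ?u ?w)"
    using max_side_times_minalt_le[of v1 v2 v3] assms(1)
    by (simp add: h_def m_def positively_oriented_def)
  have bound: "\<bar>det (columns_matrix x y)\<bar> \<le> r * q" if "norm x \<le> r" "norm y \<le> q" for x y r q
    using abs_det_columns_matrix_le[of x y] mult_mono'[OF that] by simp
  have "\<bar>det (columns_matrix d ?w)\<bar> \<le> (m / 4) * h"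
    "\<bar>det (columns_matrix ?u e)\<bar> \<le> h * (m / 4)"
    "\<bar>det (columns_matrix d e)\<bar> \<le> (m / 4) * (m / 4)"
    using de uw by (simp_all only: bound)
  moreover have "m * m \<le> h * m" using m mh by (simp add: mult_right_mono)
  moreover have "h * m > 0" using m mh by simp
  moreover have "det (columns_matrix (?u + d) (?w + e)) =
      det (columns_matrix ?u ?w) + det (columns_matrix d ?w) + det (columns_matrix ?u e)
        + det (columns_matrix d e)"
    by (simp add: det_columns_matrix algebra_simps)
  ultimately show ?thesis using main by (simp add: mult.commute)
qed

section \<open>The smallest singular value\<close>

lemma inner_transpose_mult_self:
  fixes A :: "real^'n^'n"
  shows "((transpose A ** A) *v x) \<bullet> y = (A *v x) \<bullet> (A *v y)"
  by (simp add: matrix_vector_mul_assoc[symmetric] transpose_matrix_vector dot_lmul_matrix)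

text \<open>Eigenvectors of the symmetric matrix \<open>A\<^sup>T A\<close> for different eigenvalues are orthogonal, and
  orthogonal families of nonzero vectors are finite. So the minimum in \<^const>\<open>sigma_min\<close> is a
  genuine lower bound of the singular values.\<close>

lemma finite_singular_values:
  fixes A :: "real^'n^'n"
  shows "finite (singular_values A)"
proof -
  let ?S = "singular_values A"
  define B where "B = transpose A ** A"
  have sym: "(B *v x) \<bullet> y = x \<bullet> (B *v y)" for x y
    using inner_transpose_mult_self[of A x y] inner_transpose_mult_self[of A y x]
    by (simp add: B_def inner_commute)
  have "\<forall>s\<in>?S. \<exists>x. x \<noteq> 0 \<and> B *v x = s\<^sup>2 *\<^sub>R x"
    by (auto simp: singular_values_def B_def)
  then obtain g where g: "\<And>s. s \<in> ?S \<Longrightarrow> g s \<noteq> 0 \<and> B *v g s = s\<^sup>2 *\<^sub>R g s"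
    by metis
  have orth: "g s \<bullet> g t = 0" if "s \<in> ?S" "t \<in> ?S" "s \<noteq> t" for s t
  proof -
    have "s\<^sup>2 * (g s \<bullet> g t) = t\<^sup>2 * (g s \<bullet> g t)"
      using sym[of "g s" "g t"] g that by simp
    moreover have "s\<^sup>2 \<noteq> t\<^sup>2"
      using that by (auto simp: singular_values_def power2_eq_iff_nonneg)
    ultimately show ?thesis by simp
  qed
  have inj: "inj_on g ?S"
  proof (rule inj_onI, rule ccontr)
    fix s t assume "s \<in> ?S" "t \<in> ?S" "g s = g t" "s \<noteq> t"
    with orth[of s t] g show False by auto
  qed
  have "pairwise orthogonal (g ` ?S)"
    using orth by (fastforce simp: pairwise_def orthogonal_def)
  moreover have "0 \<notin> g ` ?S" using g by (metis imageE)
  ultimately have "independent (g ` ?S)" by (rule pairwise_orthogonal_independent)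
  then have "finite (g ` ?S)" by (rule finiteI_independent)
  then show ?thesis using inj by (simp add: finite_image_iff)
qed

text \<open>The minimum \<open>\<mu>\<close> of \<open>norm (A *v x)\<close> on the unit sphere is a singular value: the quadratic form
  \<open>(norm (A *v x))\<^sup>2 - \<mu>\<^sup>2 * (norm x)\<^sup>2\<close> is nonnegative and vanishes at a minimizer, so its
  derivative vanishes there, which is the eigenvector equation.\<close>

lemma sigma_min_times_norm_le:
  fixes A :: "real^'n^'n"
  shows "sigma_min A * norm x \<le> norm (A *v x)"
proof -
  have "continuous_on (sphere 0 1) (\<lambda>x. norm (A *v x))"
    by (intro continuous_intros)
  moreover have "sphere (0 :: real^'n) 1 \<noteq> {}" by simp
  ultimately obtain z where z: "norm z = 1"
    and zmin: "\<And>y. norm y = 1 \<Longrightarrow> norm (A *v z) \<le> norm (A *v y)"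
    using continuous_attains_inf[of "sphere (0 :: real^'n) 1" "\<lambda>x. norm (A *v x)"] by auto
  define \<mu> where "\<mu> = norm (A *v z)"
  have low: "\<mu> * norm y \<le> norm (A *v y)" for y
  proof (cases "y = 0")
    case False
    then have "\<mu> \<le> norm (A *v (y /\<^sub>R norm y))"
      unfolding \<mu>_def by (intro zmin) simp
    also have "\<dots> = norm (A *v y) / norm y"
      by (simp add: matrix_vector_mult_scaleR divide_inverse mult.commute)
    finally show ?thesis using False by (simp add: pos_le_divide_eq)
  qed simp
  have "(A *v z) \<bullet> (A *v y) = \<mu>\<^sup>2 * (z \<bullet> y)" for y
  proof -
    define b where "b = (A *v z) \<bullet> (A *v y) - \<mu>\<^sup>2 * (z \<bullet> y)"
    define c where "c = (norm (A *v y))\<^sup>2 - \<mu>\<^sup>2 * (norm y)\<^sup>2"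
    have quad: "0 \<le> 2 * t * b + t\<^sup>2 * c" for t
    proof -
      have "(\<mu> * norm (z + t *\<^sub>R y))\<^sup>2 \<le> (norm (A *v (z + t *\<^sub>R y)))\<^sup>2"
        by (rule power_mono[OF low]) (simp add: \<mu>_def)
      moreover have "(norm (A *v (z + t *\<^sub>R y)))\<^sup>2
          = \<mu>\<^sup>2 + 2 * t * ((A *v z) \<bullet> (A *v y)) + t\<^sup>2 * (norm (A *v y))\<^sup>2"
        unfolding \<mu>_def power2_norm_eq_inner
        by (simp add: matrix_vector_right_distrib matrix_vector_mult_scaleR inner_add_left
            inner_add_right inner_commute power2_eq_square algebra_simps)
      moreover have "(norm (z + t *\<^sub>R y))\<^sup>2 = 1 + 2 * t * (z \<bullet> y) + t\<^sup>2 * (norm y)\<^sup>2"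
        using z unfolding power2_norm_eq_inner norm_eq_1
        by (simp add: inner_add_left inner_add_right inner_commute power2_eq_square algebra_simps)
      ultimately show ?thesis
        by (simp add: b_def c_def power_mult_distrib algebra_simps)
    qed
    have "b = 0"
    proof (rule ccontr)
      assume "b \<noteq> 0"
      \<comment> \<open>At this \<open>t\<close> the linear term outweighs the quadratic one.\<close>
      define t where "t = - b / (\<bar>c\<bar> + 1)"
      have t: "t * (\<bar>c\<bar> + 1) = - b" by (simp add: t_def)
      have "t \<noteq> 0" using \<open>b \<noteq> 0\<close> by (simp add: t_def)
      have "2 * t * b + t\<^sup>2 * c = t\<^sup>2 * (c - 2 * (\<bar>c\<bar> + 1))"
        using t by (simp add: power2_eq_square algebra_simps) algebra
      also have "\<dots> < 0" using \<open>t \<noteq> 0\<close> by (intro mult_pos_neg) auto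
      finally show False using quad[of t] by simp
    qed
    then show ?thesis by (simp add: b_def)
  qed
  then have "((transpose A ** A) *v z) \<bullet> y = (\<mu>\<^sup>2 *\<^sub>R z) \<bullet> y" for y
    by (simp add: inner_transpose_mult_self)
  then have "(transpose A ** A) *v z = \<mu>\<^sup>2 *\<^sub>R z"
    using vector_eq_rdot by blast
  then have "\<mu> \<in> singular_values A"
    using z by (auto simp: singular_values_def \<mu>_def intro!: exI[of _ z])
  then have "sigma_min A \<le> \<mu>"
    unfolding sigma_min_def by (simp add: finite_singular_values)
  then show ?thesis
    using low[of x] mult_right_mono[of "sigma_min A" \<mu> "norm x"] by simp
qed

section \<open>Linearization error\<close>

text \<open>The mean value inequality on the convex set makes \<open>f'\<close> Lipschitz with constant \<open>M\<close>, so along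
  the segment from \<open>a\<close> to \<open>b\<close> the derivative of the error at time \<open>t\<close> is at most
  \<open>M * t * (norm (b - a))\<^sup>2\<close>. Comparing with a primitive of this bound, instead of its maximum, gains
  the factor \<open>1/2\<close>.\<close>

lemma linearization_error_le:
  fixes f :: "'a::real_normed_vector \<Rightarrow> 'b::real_normed_vector"
    and f' :: "'a \<Rightarrow> 'a \<Rightarrow>\<^sub>L 'b" and f'' :: "'a \<Rightarrow> 'a \<Rightarrow>\<^sub>L ('a \<Rightarrow>\<^sub>L 'b)"
  assumes "convex S" and a: "a \<in> S" and b: "b \<in> S"
    and f: "\<And>x. x \<in> S \<Longrightarrow> (f has_derivative blinfun_apply (f' x)) (at x within S)"
    and f': "\<And>x. x \<in> S \<Longrightarrow> (f' has_derivative blinfun_apply (f'' x)) (at x within S)"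
    and M: "\<And>x. x \<in> S \<Longrightarrow> norm (f'' x) \<le> M"
  shows "norm (f b - f a - f' a (b - a)) \<le> M * (norm (b - a))\<^sup>2 / 2"
proof -
  define p where "p t = a + t *\<^sub>R (b - a)" for t :: real
  define g where "g t = f (p t) - t *\<^sub>R f' a (b - a)" for t
  have pS: "p t \<in> S" if "t \<in> {0..1}" for t
    using convexD_alt[OF \<open>convex S\<close> a b, of t] that by (simp add: p_def algebra_simps)
  have p: "(p has_derivative (\<lambda>s. s *\<^sub>R (b - a))) (at t within X)" for t X
    unfolding p_def by (auto intro!: derivative_eq_intros)
  have fp: "(f \<circ> p has_derivative (f' (p t) \<circ> (\<lambda>s. s *\<^sub>R (b - a)))) (at t within {0..1})"
    if "t \<in> {0..1}" for t
    using that pS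
    by (intro diff_chain_within p has_derivative_subset[OF f]) auto
  have g: "(g has_vector_derivative (f' (p t) - f' a) (b - a)) (at t within {0..1})"
    if "t \<in> {0..1}" for t
    using fp[OF that] unfolding g_def has_vector_derivative_def
    by (auto intro!: derivative_eq_intros simp: o_def blinfun.bilinear_simps algebra_simps)
  have lip: "norm (f' x - f' a) \<le> M * norm (x - a)" if "x \<in> S" for x
    using differentiable_bound[OF \<open>convex S\<close>, of f' "\<lambda>x. blinfun_apply (f'' x)" M x a]
      f' M a that by (simp add: norm_blinfun.rep_eq)
  have "norm (g 1 - g 0) \<le> M * (norm (b - a))\<^sup>2 / 2 * 1\<^sup>2 - M * (norm (b - a))\<^sup>2 / 2 * 0\<^sup>2"
  proof (rule differentiable_bound_general)
    show "continuous_on {0..1} g"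
      unfolding continuous_on_eq_continuous_within
      using g has_vector_derivative_continuous by blast
    show "continuous_on {0..1} (\<lambda>t. M * (norm (b - a))\<^sup>2 / 2 * t\<^sup>2)"
      by (intro continuous_intros)
    fix t :: real assume t: "0 < t" "t < 1"
    then show "(g has_vector_derivative (f' (p t) - f' a) (b - a)) (at t)"
      using g[of t] by (simp add: at_within_Icc_at)
    show "((\<lambda>t. M * (norm (b - a))\<^sup>2 / 2 * t\<^sup>2) has_vector_derivative
        M * (norm (b - a))\<^sup>2 * t) (at t)"
      unfolding has_real_derivative_iff_has_vector_derivative[symmetric]
      by (auto intro!: derivative_eq_intros)
    have "norm ((f' (p t) - f' a) (b - a)) \<le> norm (f' (p t) - f' a) * norm (b - a)"
      by (rule norm_blinfun)
    also have "\<dots> \<le> (M * norm (p t - a)) * norm (b - a)"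
      using t by (intro mult_right_mono lip pS) auto
    also have "\<dots> = M * (norm (b - a))\<^sup>2 * t"
      using t by (simp add: p_def power2_eq_square)
    finally show "norm ((f' (p t) - f' a) (b - a)) \<le> M * (norm (b - a))\<^sup>2 * t" .
  qed simp
  then show ?thesis by (simp add: g_def p_def algebra_simps)
qed

section \<open>The image triangle\<close>

theorem theorem4p1:
  fixes \<Omega> :: "(real^2) set" and \<T> :: "(real^2) set set"
    and f :: "real^2 \<Rightarrow> real^2"
    and f' :: "real^2 \<Rightarrow> (real^2) \<Rightarrow>\<^sub>L (real^2)"
    and f'' :: "real^2 \<Rightarrow> (real^2) \<Rightarrow>\<^sub>L (real^2) \<Rightarrow>\<^sub>L (real^2)"
    and T :: "(real^2) set" and v1 v2 v3 :: "real^2" and h M :: real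
  assumes "polygonal_domain \<Omega>"
    and "triangular_mesh \<T> \<Omega>"
    and "bij_betw f \<Omega> (f ` \<Omega>)"
    and "C2_on f f' f'' \<Omega>"
    and "\<And>x. x \<in> \<Omega> \<Longrightarrow> det (jacobian_matrix (f' x)) > 0"
    and "T \<in> \<T>"
    and "T = convex hull {v1, v2, v3}"
    and "positively_oriented v1 v2 v3"
    and "h = max_side v1 v2 v3"
    and "M > 0"
    and "\<And>x. x \<in> T \<Longrightarrow> norm (f'' x) \<le> M"
    and "sigma_min (jacobian_matrix (f' v1)) / M > 2 * h * asp v1 v2 v3"
  shows "\<not> negatively_oriented (f v1) (f v2) (f v3)"
proof -
  define m where "m = minalt v1 v2 v3"
  define J where "J = jacobian_matrix (f' v1)"
  define \<sigma> where "\<sigma> = sigma_min J"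
  have T_sub: "T \<subseteq> \<Omega>" using assms(2,6) by (auto simp: triangular_mesh_def)
  have vT: "v1 \<in> T" "v2 \<in> T" "v3 \<in> T" using assms(7) by (auto simp: hull_inc)
  have detJ: "det J > 0" using assms(5) vT T_sub by (auto simp: J_def)
  have J: "J *v x = f' v1 x" for x
    by (simp add: J_def jacobian_matrix_def matrix_works bounded_linear.linear
        blinfun.bounded_linear_right)
  have m: "m > 0" and h: "h > 0"
    using minalt_pos[OF assms(8)] minalt_le_max_side[of v1 v2 v3] assms(9)
    by (simp_all add: m_def)
  have "2 * h * (h / m) < \<sigma> / M"
    using assms(9,12) by (simp add: asp_def m_def \<sigma>_def J_def)
  then have \<sigma>: "2 * M * h\<^sup>2 < \<sigma> * m"
    using m \<open>M > 0\<close> by (simp add: field_simps power2_eq_square)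
  then have "\<sigma> > 0"
    using m \<open>M > 0\<close> by (smt (verit) mult_nonneg_nonneg mult_nonpos_nonneg zero_le_power2)
  \<comment> \<open>Pulled back through \<open>J\<close>, the linearization error at a vertex displaces it by less than a
    quarter of the minimal altitude.\<close>
  have pull_back: "\<exists>d. f v - f v1 = J *v (v - v1 + d) \<and> norm d \<le> m / 4"
    if v: "v \<in> T" "dist v1 v \<le> h" for v
  proof -
    define e where "e = f v - f v1 - f' v1 (v - v1)"
    have "norm e \<le> M * (norm (v - v1))\<^sup>2 / 2"
      unfolding e_def
    proof (rule linearization_error_le[of T])
      show "convex T" by (simp add: assms(7) convex_convex_hull)
    next
      fix x assume "x \<in> T"
      then show "(f has_derivative blinfun_apply (f' x)) (at x within T)"
        "(f' has_derivative blinfun_apply (f'' x)) (at x within T)"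
        using assms(4) T_sub unfolding C2_on_def by (meson has_derivative_subset subsetD)+
    qed (use vT v assms(11) in auto)
    also have "\<dots> \<le> M * h\<^sup>2 / 2"
      using v \<open>M > 0\<close> by (simp add: dist_norm norm_minus_commute power_mono)
    finally have e: "norm e \<le> M * h\<^sup>2 / 2" .
    obtain K where "J ** K = mat 1"
      using detJ invertible_det_nz[of J] by (auto simp: invertible_def)
    then obtain d where d: "J *v d = e"
      by (metis matrix_vector_mul_assoc matrix_vector_mul_lid)
    have "\<sigma> * norm d \<le> norm e"
      using sigma_min_times_norm_le[of J d] by (simp add: \<sigma>_def d)
    then have "\<sigma> * norm d \<le> \<sigma> * (m / 4)" using e \<sigma> by simp
    then have "norm d \<le> m / 4" using \<open>\<sigma> > 0\<close> by simp
    moreover have "f v - f v1 = J *v (v - v1 + d)"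
      unfolding matrix_vector_right_distrib d by (simp add: e_def J)
    ultimately show ?thesis by blast
  qed
  obtain d e where d: "f v2 - f v1 = J *v (v2 - v1 + d)" "norm d \<le> m / 4"
    and e: "f v3 - f v1 = J *v (v3 - v1 + e)" "norm e \<le> m / 4"
    using pull_back[OF vT(2)] pull_back[OF vT(3)] dist_le_max_side assms(9) by metis
  have "det (columns_matrix (f v2 - f v1) (f v3 - f v1)) > 0"
    unfolding d e det_columns_matrix_mult
    using detJ positive_det_perturbed[OF assms(8)] d(2) e(2) by (simp add: m_def)
  then show ?thesis by (simp add: negatively_oriented_def)
qed

end
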